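(* If a complex sequence $a=\{a_k\}_{k=0}^\infty$ fulfills the condition $$\sum_{k=1}^\infty\sqrt{k}\,|a_k|<\infty,$$ then the $L$-matrix given by the parameter sequence $a$ is a matrix representation (in the standard basis) of a trace class operator $L$ on $\ell^2(\mathbb{N}_0)$. Moreover, for any $p\ge1$, we have the estimate $$\|L\|_{\mathscr{J}_p}\le\sum_{k=0}^\infty|a_k|\left((\mu_+(k))^{p/2}+(\mu_-(k))^{p/2}\right)^{1/p},$$ where $$\mu_\pm(k)=k+\frac12\pm\sqrt{k+\frac14}.$$
   Context: $\mathbb{N}_0=\{0,1,2,\dots\}$. The $L$-matrix with parameter sequence $a$ is the semi-infinite matrix with entries $\mathcal{L}_{m,n}=a_{\max(m,n)}$, $m,n\in\mathbb{N}_0$. For $p\ge1$, $\mathscr{J}_p$ is the $p$-th Schatten class and $\|\cdot\|_{\mathscr{J}_p}$ the $p$-th Schatten norm; $\mathscr{J}_1$ is the ideal of trace class operators. *)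

theory Defs
  imports "HOL-Analysis.Analysis"
begin

section \<open>The Hilbert space of square-summable complex sequences\<close>

typedef ell2 = "{x :: nat \<Rightarrow> complex. summable (\<lambda>n. (cmod (x n))\<^sup>2)}"
  morphisms ell2_nth Abs_ell2
  by (rule exI[of _ "\<lambda>_. 0"]) simp

setup_lifting type_definition_ell2

lemma summable_ell2_nth: "summable (\<lambda>n. (cmod (ell2_nth x n))\<^sup>2)"
  using ell2_nth[of x] by simp

lemma summable_norm_mult:
  fixes x y :: "nat \<Rightarrow> complex"
  assumes "summable (\<lambda>n. (cmod (x n))\<^sup>2)" "summable (\<lambda>n. (cmod (y n))\<^sup>2)"
  shows "summable (\<lambda>n. norm (x n * cnj (y n)))"
proof (rule summable_comparison_test')
  show "summable (\<lambda>n. (cmod (x n))\<^sup>2 + (cmod (y n))\<^sup>2)"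
    using assms by (rule summable_add)
  show "norm (norm (x n * cnj (y n))) \<le> (cmod (x n))\<^sup>2 + (cmod (y n))\<^sup>2" if "n \<ge> 0" for n
  proof -
    have "0 \<le> (cmod (x n) - cmod (y n))\<^sup>2" by simp
    moreover have "0 \<le> (cmod (x n))\<^sup>2" "0 \<le> (cmod (y n))\<^sup>2" by simp_all
    ultimately have "cmod (x n) * cmod (y n) \<le> (cmod (x n))\<^sup>2 + (cmod (y n))\<^sup>2"
      unfolding power2_diff by linarith
    then show ?thesis by (simp add: norm_mult)
  qed
qed

lemma square_summable_add:
  fixes x y :: "nat \<Rightarrow> complex"
  assumes "summable (\<lambda>n. (cmod (x n))\<^sup>2)" "summable (\<lambda>n. (cmod (y n))\<^sup>2)"
  shows "summable (\<lambda>n. (cmod (x n + y n))\<^sup>2)"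
proof (rule summable_comparison_test')
  show "summable (\<lambda>n. 2 * ((cmod (x n))\<^sup>2 + (cmod (y n))\<^sup>2))"
    using assms by (intro summable_mult summable_add)
  show "norm ((cmod (x n + y n))\<^sup>2) \<le> 2 * ((cmod (x n))\<^sup>2 + (cmod (y n))\<^sup>2)" if "n \<ge> 0" for n
  proof -
    have "(cmod (x n + y n))\<^sup>2 \<le> (cmod (x n) + cmod (y n))\<^sup>2"
      by (intro power_mono norm_triangle_ineq) simp
    moreover have "0 \<le> (cmod (x n) - cmod (y n))\<^sup>2" by simp
    ultimately have "(cmod (x n + y n))\<^sup>2 \<le> 2 * ((cmod (x n))\<^sup>2 + (cmod (y n))\<^sup>2)"
      by (simp add: power2_diff power2_sum distrib_left)
    then show ?thesis by simp
  qed
qed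

lemma square_summable_scale:
  fixes x :: "nat \<Rightarrow> complex"
  assumes "summable (\<lambda>n. (cmod (x n))\<^sup>2)"
  shows "summable (\<lambda>n. (cmod (c * x n))\<^sup>2)"
  using summable_mult[OF assms, of "(cmod c)\<^sup>2"]
  by (simp add: norm_mult power_mult_distrib)

lift_definition cscale :: "complex \<Rightarrow> ell2 \<Rightarrow> ell2"  (infixr "*\<^sub>C" 75)
  is "\<lambda>c x n. c * x n"
  by (rule square_summable_scale)

text \<open>The inner product is linear in the first argument.\<close>

definition cinner :: "ell2 \<Rightarrow> ell2 \<Rightarrow> complex" where
  "cinner x y = (\<Sum>n. ell2_nth x n * cnj (ell2_nth y n))"

instantiation ell2 :: real_inner
begin

lift_definition zero_ell2 :: ell2 is "\<lambda>_. 0" by simp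

lift_definition plus_ell2 :: "ell2 \<Rightarrow> ell2 \<Rightarrow> ell2" is "\<lambda>x y n. x n + y n"
  by (rule square_summable_add)

lift_definition uminus_ell2 :: "ell2 \<Rightarrow> ell2" is "\<lambda>x n. - x n" by simp

definition minus_ell2 :: "ell2 \<Rightarrow> ell2 \<Rightarrow> ell2" where
  "minus_ell2 x y = x + - y"

definition scaleR_ell2 :: "real \<Rightarrow> ell2 \<Rightarrow> ell2" where
  "scaleR_ell2 r x = complex_of_real r *\<^sub>C x"

definition inner_ell2 :: "ell2 \<Rightarrow> ell2 \<Rightarrow> real" where
  "inner_ell2 x y = Re (cinner x y)"

definition norm_ell2 :: "ell2 \<Rightarrow> real" where
  "norm_ell2 x = sqrt (\<Sum>n. (cmod (ell2_nth x n))\<^sup>2)"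

definition dist_ell2 :: "ell2 \<Rightarrow> ell2 \<Rightarrow> real" where
  "dist_ell2 x y = norm (x - y)"

definition sgn_ell2 :: "ell2 \<Rightarrow> ell2" where
  "sgn_ell2 x = inverse (norm x) *\<^sub>R x"

definition uniformity_ell2 :: "(ell2 \<times> ell2) filter" where
  "uniformity_ell2 = (INF e\<in>{0<..}. principal {(x, y). dist x y < e})"

definition open_ell2 :: "ell2 set \<Rightarrow> bool" where
  "open_ell2 U \<longleftrightarrow> (\<forall>x\<in>U. \<forall>\<^sub>F (x', y) in uniformity. x' = x \<longrightarrow> y \<in> U)"

lemma summable_cinner: "summable (\<lambda>n. ell2_nth x n * cnj (ell2_nth y n))"
  by (rule summable_norm_cancel)
    (rule summable_norm_mult[OF summable_ell2_nth summable_ell2_nth])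

lemma inner_ell2_suminf:
  "inner x y = (\<Sum>n. Re (ell2_nth x n * cnj (ell2_nth y n)))" for x y :: ell2
  unfolding inner_ell2_def cinner_def by (rule Re_suminf[OF summable_cinner])

lemma inner_ell2_self: "inner x x = (\<Sum>n. (cmod (ell2_nth x n))\<^sup>2)" for x :: ell2
  unfolding inner_ell2_suminf
  by (simp add: cmod_power2 flip: power2_eq_square)

instance
proof
  fix x y z :: ell2 and r s :: real
  show "x + y + z = x + (y + z)" by transfer (simp add: add.assoc)
  show "x + y = y + x" by transfer (simp add: add.commute)
  show "0 + x = x" by transfer simp
  show "- x + x = 0" by transfer simp
  show "x - y = x + - y" by (rule minus_ell2_def)
  show "r *\<^sub>R (x + y) = r *\<^sub>R x + r *\<^sub>R y"
    unfolding scaleR_ell2_def by transfer (simp add: algebra_simps)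
  show "(r + s) *\<^sub>R x = r *\<^sub>R x + s *\<^sub>R x"
    unfolding scaleR_ell2_def by transfer (simp add: algebra_simps)
  show "r *\<^sub>R s *\<^sub>R x = (r * s) *\<^sub>R x"
    unfolding scaleR_ell2_def by transfer (simp add: algebra_simps)
  show "1 *\<^sub>R x = x" unfolding scaleR_ell2_def by transfer simp
  show "dist x y = norm (x - y)" by (rule dist_ell2_def)
  show "sgn x = inverse (norm x) *\<^sub>R x" by (rule sgn_ell2_def)
  show "(uniformity :: (ell2 \<times> ell2) filter)
      = (INF e\<in>{0<..}. principal {(x, y). dist x y < e})"
    by (rule uniformity_ell2_def)
  show "open U \<longleftrightarrow> (\<forall>x\<in>U. \<forall>\<^sub>F (x', y) in uniformity. x' = x \<longrightarrow> y \<in> U)" for U :: "ell2 set"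
    by (rule open_ell2_def)
  show "inner x y = inner y x"
    unfolding inner_ell2_suminf by (simp add: mult.commute)
  show "inner (x + y) z = inner x z + inner y z"
  proof -
    have "cinner (x + y) z = cinner x z + cinner y z"
      unfolding cinner_def suminf_add[OF summable_cinner summable_cinner]
      by (simp add: plus_ell2.rep_eq algebra_simps)
    then show ?thesis by (simp add: inner_ell2_def)
  qed
  show "inner (r *\<^sub>R x) y = r * inner x y"
  proof -
    have "cinner (r *\<^sub>R x) y = complex_of_real r * cinner x y"
      unfolding cinner_def suminf_mult[OF summable_cinner, symmetric]
      by (simp add: scaleR_ell2_def cscale.rep_eq mult.assoc)
    then show ?thesis by (simp add: inner_ell2_def)
  qed
  show "0 \<le> inner x x"
    unfolding inner_ell2_self by (rule suminf_nonneg[OF summable_ell2_nth]) simp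
  show "inner x x = 0 \<longleftrightarrow> x = 0"
    unfolding inner_ell2_self
    by (subst suminf_eq_zero_iff[OF summable_ell2_nth]) (simp_all, transfer, auto)
  show "norm x = sqrt (inner x x)"
    unfolding inner_ell2_self by (rule norm_ell2_def)
qed

end

text \<open>Complex linearity, span and dimension come from the locale of vector spaces over a field;
  the dimension of the type class of real vector spaces would count real dimensions.\<close>

global_interpretation ell2: vector_space cscale
  by standard (transfer; simp add: algebra_simps)+

lift_definition basis_vec :: "nat \<Rightarrow> ell2" is "\<lambda>n k. if k = n then 1 else 0"
proof -
  fix n :: nat
  show "summable (\<lambda>k. (cmod (if k = n then 1 else 0))\<^sup>2)"
    by (rule summable_finite[of "{n}"]) auto
qed

section \<open>Operators and Schatten classes\<close>

definition bounded_op :: "(ell2 \<Rightarrow> ell2) \<Rightarrow> bool" where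
  "bounded_op T \<longleftrightarrow>
     Vector_Spaces.linear cscale cscale T \<and> (\<exists>K. \<forall>x. norm (T x) \<le> K * norm x)"

definition compact_op :: "(ell2 \<Rightarrow> ell2) \<Rightarrow> bool" where
  "compact_op T \<longleftrightarrow> bounded_op T \<and> compact (closure (T ` cball 0 1))"

text \<open>Meaningful for bounded operators, where existence is the Riesz representation theorem.\<close>

definition adjoint_op :: "(ell2 \<Rightarrow> ell2) \<Rightarrow> ell2 \<Rightarrow> ell2" where
  "adjoint_op T = (THE S. \<forall>x y. cinner (T x) y = cinner x (S y))"

text \<open>The singular values of \<open>T\<close> are the square roots of the eigenvalues of \<open>T\<^sup>* T\<close>,
  each repeated according to the dimension of its eigenspace.  Only the positive ones matter for
  Schatten norms, and for compact \<open>T\<close> these have finite multiplicity, so the convention that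
  an infinite-dimensional space has \<open>dim\<close> equal to \<open>0\<close> is harmless.\<close>

definition sing_space :: "(ell2 \<Rightarrow> ell2) \<Rightarrow> real \<Rightarrow> ell2 set" where
  "sing_space T s = {x. adjoint_op T (T x) = complex_of_real (s\<^sup>2) *\<^sub>C x}"

definition sing_vals :: "(ell2 \<Rightarrow> ell2) \<Rightarrow> real set" where
  "sing_vals T = {s. s > 0 \<and> (\<exists>x\<in>sing_space T s. x \<noteq> 0)}"

definition sing_mult :: "(ell2 \<Rightarrow> ell2) \<Rightarrow> real \<Rightarrow> nat" where
  "sing_mult T s = ell2.dim (sing_space T s)"

definition schatten_class :: "real \<Rightarrow> (ell2 \<Rightarrow> ell2) set" where
  "schatten_class p =
     {T. compact_op T \<and> (\<lambda>s. real (sing_mult T s) * s powr p) summable_on sing_vals T}"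

definition schatten_norm :: "real \<Rightarrow> (ell2 \<Rightarrow> ell2) \<Rightarrow> real" where
  "schatten_norm p T = (\<Sum>\<^sub>\<infinity>s\<in>sing_vals T. real (sing_mult T s) * s powr p) powr (1 / p)"

abbreviation trace_class :: "(ell2 \<Rightarrow> ell2) set" where
  "trace_class \<equiv> schatten_class 1"

section \<open>L-matrices\<close>

definition L_matrix :: "(nat \<Rightarrow> complex) \<Rightarrow> nat \<Rightarrow> nat \<Rightarrow> complex" where
  "L_matrix a m n = a (max m n)"

definition matrix_represents :: "(nat \<Rightarrow> nat \<Rightarrow> complex) \<Rightarrow> (ell2 \<Rightarrow> ell2) \<Rightarrow> bool" where
  "matrix_represents A T \<longleftrightarrow> (\<forall>m n. cinner (T (basis_vec n)) (basis_vec m) = A m n)"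

definition mu_plus :: "nat \<Rightarrow> real" where
  "mu_plus k = real k + 1 / 2 + sqrt (real k + 1 / 4)"

definition mu_minus :: "nat \<Rightarrow> real" where
  "mu_minus k = real k + 1 / 2 - sqrt (real k + 1 / 4)"

end

theory Submission
  imports Defs
begin

text \<open>The Schatten norm of an operator \<open>T\<close> is controlled by the sums \<open>\<Sum>\<^sub>i \<bar>\<langle>T e\<^sub>i, f\<^sub>i\<rangle>\<bar>\<^sup>p\<close>
  over finite orthonormal systems \<open>e\<close>, \<open>f\<close>: taking for \<open>e\<close> singular vectors and for \<open>f\<close> their
  normalised images turns such a sum into a sum of powers of singular values.  In this form the
  triangle inequality is just Minkowski's inequality, so neither the spectral theorem nor the
  Schatten ideal property is needed.  It is applied to \<open>L = \<Sum>\<^sub>k a\<^sub>k E\<^sub>k\<close>, where \<open>E\<^sub>k\<close> is the L-matrix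
  whose only nonzero parameter is the \<open>k\<close>-th, equal to \<open>1\<close>.  It is a self-adjoint matrix of rank at
  most two with squared eigenvalues \<open>\<mu>\<^sub>\<plusminus>(k)\<close>, so that Jensen's and Bessel's inequalities bound its
  sums by \<open>\<mu>\<^sub>+(k)\<^bsup>p/2\<^esup> + \<mu>\<^sub>-(k)\<^bsup>p/2\<^esup>\<close>.\<close>

section \<open>The inner product and completeness\<close>

lemma cinner_add_left: "cinner (x + y) z = cinner x z + cinner y z"
  unfolding cinner_def suminf_add[OF summable_cinner summable_cinner]
  by (simp add: plus_ell2.rep_eq algebra_simps)

lemma cinner_scale_left: "cinner (c *\<^sub>C x) y = c * cinner x y"
  unfolding cinner_def suminf_mult[OF summable_cinner, symmetric]
  by (simp add: cscale.rep_eq mult.assoc)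

lemma cinner_commute: "cinner y x = cnj (cinner x y)"
proof -
  have "(\<lambda>n. cnj (ell2_nth x n * cnj (ell2_nth y n))) sums cnj (cinner x y)"
    unfolding cinner_def by (rule sums_cnj[THEN iffD2, OF summable_sums[OF summable_cinner]])
  then show ?thesis
    unfolding cinner_def by (simp add: sums_iff mult.commute)
qed

lemma cinner_add_right: "cinner x (y + z) = cinner x y + cinner x z"
  by (subst (1 2 3) cinner_commute) (simp add: cinner_add_left)

lemma cinner_scale_right: "cinner x (c *\<^sub>C y) = cnj c * cinner x y"
  by (subst (1 2) cinner_commute) (simp add: cinner_scale_left)

lemma cinner_zero_left [simp]: "cinner 0 y = 0"
  using cinner_scale_left[of 0 0 y] by simp

lemma cinner_zero_right [simp]: "cinner x 0 = 0"
  using cinner_commute[of x 0] by simp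

lemma cinner_diff_left: "cinner (x - y) z = cinner x z - cinner y z"
  using cinner_add_left[of "x - y" y z] by (simp add: algebra_simps)

lemma cinner_diff_right: "cinner x (y - z) = cinner x y - cinner x z"
  using cinner_add_right[of x "y - z" z] by (simp add: algebra_simps)

lemma cinner_sum_left: "cinner (\<Sum>i\<in>I. f i) y = (\<Sum>i\<in>I. cinner (f i) y)"
  by (induction I rule: infinite_finite_induct) (simp_all add: cinner_add_left)

lemma cinner_sum_right: "cinner x (\<Sum>i\<in>I. f i) = (\<Sum>i\<in>I. cinner x (f i))"
  by (induction I rule: infinite_finite_induct) (simp_all add: cinner_add_right)

lemma cinner_self: "cinner x x = complex_of_real ((norm x)\<^sup>2)"
proof (rule complex_eqI)
  show "Re (cinner x x) = Re (complex_of_real ((norm x)\<^sup>2))"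
    by (simp add: power2_norm_eq_inner inner_ell2_def)
  show "Im (cinner x x) = Im (complex_of_real ((norm x)\<^sup>2))"
    using arg_cong[OF cinner_commute[of x x], of Im] by simp
qed

lemma cinner_self_eq_zero_iff: "cinner x x = 0 \<longleftrightarrow> x = 0"
  by (simp add: cinner_self)

lemma norm_cscale: "norm (c *\<^sub>C x) = cmod c * norm x"
proof -
  have "cinner (c *\<^sub>C x) (c *\<^sub>C x) = (c * cnj c) * cinner x x"
    by (simp add: cinner_scale_left cinner_scale_right)
  also have "\<dots> = complex_of_real ((cmod c * norm x)\<^sup>2)"
    by (simp only: cinner_self complex_norm_square[symmetric] of_real_mult[symmetric]
        power_mult_distrib)
  finally have "(norm (c *\<^sub>C x))\<^sup>2 = (cmod c * norm x)\<^sup>2"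
    unfolding cinner_self of_real_eq_iff .
  then show ?thesis
    by (rule power2_eq_imp_eq) simp_all
qed

lemma scaleR_eq_cscale: "r *\<^sub>R x = complex_of_real r *\<^sub>C x" for x :: ell2
  by (rule scaleR_ell2_def)

section \<open>Coordinates and completeness of \<open>ell2\<close>\<close>

lemma power2_norm_ell2: "(norm x)\<^sup>2 = (\<Sum>n. (cmod (ell2_nth x n))\<^sup>2)"
  using inner_ell2_self[of x] by (simp only: power2_norm_eq_inner[of x])

lemma cmod_ell2_nth_le_norm: "cmod (ell2_nth x n) \<le> norm x"
proof -
  have "(\<Sum>i\<in>{n}. (cmod (ell2_nth x i))\<^sup>2) \<le> (\<Sum>n. (cmod (ell2_nth x n))\<^sup>2)"
    by (rule sum_le_suminf[OF summable_ell2_nth]) auto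
  then show ?thesis
    unfolding norm_ell2_def by (intro real_le_rsqrt) simp
qed

lemma ell2_nth_minus: "ell2_nth (x - y) n = ell2_nth x n - ell2_nth y n"
  unfolding minus_ell2_def plus_ell2.rep_eq uminus_ell2.rep_eq by simp

text \<open>Coordinates of a Cauchy sequence converge; the limit sequence is square summable because
  the bounds on finite sections survive the limit. Completeness serves twice: absolutely convergent
  series converge, and total boundedness yields compactness.\<close>

instance ell2 :: banach
proof
  fix X :: "nat \<Rightarrow> ell2"
  assume X: "Cauchy X"
  have "convergent (\<lambda>m. ell2_nth (X m) n)" for n
  proof (rule Cauchy_convergent, rule metric_CauchyI)
    fix e :: real
    assume "e > 0"
    then obtain M where M: "\<And>m k. m \<ge> M \<Longrightarrow> k \<ge> M \<Longrightarrow> dist (X m) (X k) < e"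
      using metric_CauchyD[OF X] by blast
    have "dist (ell2_nth (X m) n) (ell2_nth (X k) n) < e" if "m \<ge> M" "k \<ge> M" for m k
      using M[OF that] cmod_ell2_nth_le_norm[of "X m - X k" n]
      by (simp add: dist_norm ell2_nth_minus)
    then show "\<exists>M. \<forall>m\<ge>M. \<forall>k\<ge>M. dist (ell2_nth (X m) n) (ell2_nth (X k) n) < e"
      by blast
  qed
  then obtain y where y: "\<And>n. (\<lambda>m. ell2_nth (X m) n) \<longlonglongrightarrow> y n"
    unfolding convergent_def by metis
  \<comment> \<open>Finite sections are bounded uniformly in \<open>N\<close> because the square
    summability of \<open>X m - y\<close> is not yet known. For fixed \<open>N\<close>, let
    \<open>k\<close> tend to infinity in the Cauchy estimate.\<close>
  have tail: "\<exists>M. \<forall>m\<ge>M. \<forall>N. (\<Sum>n<N. (cmod (ell2_nth (X m) n - y n))\<^sup>2) \<le> e\<^sup>2"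
    if e: "e > 0" for e
  proof -
    obtain M where M: "\<And>m k. m \<ge> M \<Longrightarrow> k \<ge> M \<Longrightarrow> dist (X m) (X k) < e"
      using metric_CauchyD[OF X e] by blast
    have "(\<Sum>n<N. (cmod (ell2_nth (X m) n - y n))\<^sup>2) \<le> e\<^sup>2" if m: "m \<ge> M" for m N
    proof (rule LIMSEQ_le_const2)
      show "(\<lambda>k. \<Sum>n<N. (cmod (ell2_nth (X m) n - ell2_nth (X k) n))\<^sup>2)
          \<longlonglongrightarrow> (\<Sum>n<N. (cmod (ell2_nth (X m) n - y n))\<^sup>2)"
        by (intro tendsto_intros y)
      have "(\<Sum>n<N. (cmod (ell2_nth (X m) n - ell2_nth (X k) n))\<^sup>2) \<le> e\<^sup>2" if k: "k \<ge> M" for k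
      proof -
        have "(\<Sum>n<N. (cmod (ell2_nth (X m - X k) n))\<^sup>2) \<le> (norm (X m - X k))\<^sup>2"
          unfolding power2_norm_ell2
          by (rule sum_le_suminf[OF summable_ell2_nth]) auto
        also have "\<dots> \<le> e\<^sup>2"
          using M[OF m k] by (intro power_mono) (simp_all add: dist_norm)
        finally show ?thesis by (simp add: ell2_nth_minus)
      qed
      then show "\<exists>K. \<forall>k\<ge>K. (\<Sum>n<N. (cmod (ell2_nth (X m) n - ell2_nth (X k) n))\<^sup>2) \<le> e\<^sup>2"
        by blast
    qed
    then show ?thesis by blast
  qed
  have summable_diff: "summable (\<lambda>n. (cmod (ell2_nth (X m) n - y n))\<^sup>2)"
    if "\<And>N. (\<Sum>n<N. (cmod (ell2_nth (X m) n - y n))\<^sup>2) \<le> e\<^sup>2" for m e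
    by (rule summableI_nonneg_bounded[of _ "e\<^sup>2"]) (use that in auto)
  obtain M where M: "\<And>N. (\<Sum>n<N. (cmod (ell2_nth (X M) n - y n))\<^sup>2) \<le> 1\<^sup>2"
    using tail[of 1] by auto
  \<comment> \<open>Here \<open>y\<close> is written as \<open>X M - (X M - y)\<close>, a difference
    of two square-summable sequences.\<close>
  have "summable (\<lambda>n. (cmod (ell2_nth (X M) n + (- 1) * (ell2_nth (X M) n - y n)))\<^sup>2)"
    by (intro square_summable_add square_summable_scale summable_ell2_nth summable_diff[OF M])
  then have nth_Y: "ell2_nth (Abs_ell2 y) = y"
    by (intro Abs_ell2_inverse) simp
  have "X \<longlonglongrightarrow> Abs_ell2 y"
  proof (rule metric_LIMSEQ_I)
    fix e :: real
    assume e: "e > 0"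
    then obtain M where
      M: "\<And>m N. m \<ge> M \<Longrightarrow> (\<Sum>n<N. (cmod (ell2_nth (X m) n - y n))\<^sup>2) \<le> (e / 2)\<^sup>2"
      using tail[of "e / 2"] by auto
    have "dist (X m) (Abs_ell2 y) < e" if m: "m \<ge> M" for m
    proof -
      have "(norm (X m - Abs_ell2 y))\<^sup>2 \<le> (e / 2)\<^sup>2"
        unfolding power2_norm_ell2 ell2_nth_minus nth_Y
        by (rule suminf_le_const[OF summable_diff]) (use M[OF m] in auto)
      then have "norm (X m - Abs_ell2 y) \<le> e / 2"
        by (rule power2_le_imp_le) (use e in simp)
      then show ?thesis
        using e by (simp add: dist_norm)
    qed
    then show "\<exists>M. \<forall>m\<ge>M. dist (X m) (Abs_ell2 y) < e" by blast
  qed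
  then show "convergent X" by (rule convergentI)
qed

section \<open>Bounds along orthogonal systems\<close>

text \<open>Vectors of norm less than one are allowed, since Bessel's inequality survives and
  normalised zero vectors are then covered.\<close>

definition orthogonal_contractions :: "'i set \<Rightarrow> ('i \<Rightarrow> ell2) \<Rightarrow> bool" where
  "orthogonal_contractions I u \<longleftrightarrow>
     (\<forall>i\<in>I. norm (u i) \<le> 1) \<and> (\<forall>i\<in>I. \<forall>j\<in>I. i \<noteq> j \<longrightarrow> cinner (u i) (u j) = 0)"

text \<open>Expand \<open>norm (x - y)\<close> squared, where \<open>y\<close> is the sum of the
  components of \<open>x\<close> along the \<open>u i\<close>. For contractions the squared norm of
  \<open>y\<close> is only at most \<open>S\<close>, which is the direction required.\<close>

lemma bessel_inequality:
  assumes "finite I" and u: "orthogonal_contractions I u"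
  shows "(\<Sum>i\<in>I. (cmod (cinner x (u i)))\<^sup>2) \<le> (norm x)\<^sup>2"
proof -
  define y where "y = (\<Sum>i\<in>I. cinner x (u i) *\<^sub>C u i)"
  define S where "S = (\<Sum>i\<in>I. (cmod (cinner x (u i)))\<^sup>2)"
  have xy: "cinner x y = complex_of_real S"
    by (simp add: y_def S_def cinner_sum_right cinner_scale_right mult.commute complex_norm_square
        del: of_real_power)
  have "cinner y y = (\<Sum>i\<in>I. cinner x (u i) * cinner (u i) y)"
    by (subst (1) y_def) (simp add: cinner_sum_left cinner_scale_left)
  also have "\<dots>
      = (\<Sum>i\<in>I. \<Sum>j\<in>I. cinner x (u i) * (cnj (cinner x (u j)) * cinner (u i) (u j)))"
    by (simp add: y_def cinner_sum_right cinner_scale_right sum_distrib_left)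
  also have "\<dots> = (\<Sum>i\<in>I. \<Sum>j\<in>I. if i = j then
      complex_of_real ((cmod (cinner x (u i)))\<^sup>2 * (norm (u i))\<^sup>2) else 0)"
  proof (intro sum.cong refl)
    fix i j
    assume "i \<in> I" "j \<in> I"
    then show "cinner x (u i) * (cnj (cinner x (u j)) * cinner (u i) (u j))
      = (if i = j then complex_of_real ((cmod (cinner x (u i)))\<^sup>2 * (norm (u i))\<^sup>2) else 0)"
      using u by (auto simp: orthogonal_contractions_def cinner_self complex_norm_square
          simp flip: mult.assoc simp del: of_real_power)
  qed
  also have "\<dots> = complex_of_real (\<Sum>i\<in>I. (cmod (cinner x (u i)))\<^sup>2 * (norm (u i))\<^sup>2)"
    using assms(1) by simp
  finally have "(norm y)\<^sup>2 = (\<Sum>i\<in>I. (cmod (cinner x (u i)))\<^sup>2 * (norm (u i))\<^sup>2)"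
    unfolding cinner_self of_real_eq_iff .
  also have "\<dots> \<le> S"
    unfolding S_def using u
    by (intro sum_mono mult_right_le_one_le) (auto simp: orthogonal_contractions_def power_le_one)
  finally have "(norm y)\<^sup>2 \<le> S" .
  moreover have "0 \<le> (norm x)\<^sup>2 + (norm y)\<^sup>2 - 2 * S"
  proof -
    have "inner x y = S" by (simp add: inner_ell2_def xy)
    then have "(norm (x - y))\<^sup>2 = (norm x)\<^sup>2 + (norm y)\<^sup>2 - 2 * S"
      using dot_norm_neg[of x y] by simp
    then show ?thesis using zero_le_power2[of "norm (x - y)"] by simp
  qed
  ultimately show ?thesis by (simp add: S_def)
qed

text \<open>Cauchy-Schwarz for the complex inner product, as Bessel's inequality for the single
  vector \<open>sgn y\<close>.\<close>

lemma cmod_cinner_le: "cmod (cinner x y) \<le> norm x * norm y"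
proof (cases "y = 0")
  case False
  have "orthogonal_contractions {()} (\<lambda>_. sgn y)"
    using False by (simp add: orthogonal_contractions_def norm_sgn)
  from bessel_inequality[OF _ this, of x] have "cmod (cinner x (sgn y)) \<le> norm x"
    by (simp add: power2_le_iff_abs_le)
  moreover have "cmod (cinner x (sgn y)) = cmod (cinner x y) / norm y"
    unfolding sgn_div_norm scaleR_eq_cscale cinner_scale_right
    by (simp add: norm_mult norm_inverse divide_inverse mult.commute)
  ultimately show ?thesis
    using False by (simp add: pos_divide_le_eq)
qed simp

text \<open>Jensen's inequality for weights of total \<open>W\<close> at most one: after normalising
  by \<open>W\<close> a factor \<open>W powr (p - 1)\<close> remains, which is at most one as
  \<open>p \<ge> 1\<close>.\<close>

lemma powr_sum_le_sum_powr:
  fixes w x :: "'j \<Rightarrow> real"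
  assumes "finite J" and w: "\<And>j. j \<in> J \<Longrightarrow> w j \<ge> 0" and w_le: "(\<Sum>j\<in>J. w j) \<le> 1"
    and x: "\<And>j. j \<in> J \<Longrightarrow> x j \<ge> 0" and p: "p \<ge> 1"
  shows "(\<Sum>j\<in>J. w j * x j) powr p \<le> (\<Sum>j\<in>J. w j * x j powr p)"
proof -
  \<comment> \<open>Dropping the vanishing terms leaves arguments in the open half-line, where
    \<open>powr_convex\<close> applies, and makes \<open>W\<close> positive.\<close>
  define K where "K = {j \<in> J. w j * x j \<noteq> 0}"
  have K: "finite K" "K \<subseteq> J" "\<And>j. j \<in> K \<Longrightarrow> w j > 0 \<and> x j > 0"
    using assms(1) w x by (auto simp: K_def order_less_le)
  have to_K: "(\<Sum>j\<in>J. w j * x j) = (\<Sum>j\<in>K. w j * x j)"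
    "(\<Sum>j\<in>J. w j * x j powr p) = (\<Sum>j\<in>K. w j * x j powr p)"
    using assms(1) K(2) by (auto intro!: sum.mono_neutral_right simp: K_def)
  show ?thesis
  proof (cases "K = {}")
    case False
    define W where "W = (\<Sum>j\<in>K. w j)"
    have "W > 0" unfolding W_def using K False by (intro sum_pos) auto
    have "W \<le> 1"
      using w_le sum_mono2[OF assms(1) K(2), of w] w by (auto simp: W_def)
    have "(\<Sum>j\<in>K. w j * x j) = W * (\<Sum>j\<in>K. (w j / W) *\<^sub>R x j)"
      using \<open>W > 0\<close> by (simp add: sum_distrib_left)
    then have "(\<Sum>j\<in>K. w j * x j) powr p = W powr p * (\<Sum>j\<in>K. (w j / W) *\<^sub>R x j) powr p"
      by (simp add: powr_mult)
    also have "\<dots> \<le> W powr p * (\<Sum>j\<in>K. w j / W * x j powr p)"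
    proof (intro mult_left_mono convex_on_sum[OF K(1) False powr_convex[OF p]])
      show "(\<Sum>j\<in>K. w j / W) = 1"
        unfolding sum_divide_distrib[symmetric] W_def[symmetric] using \<open>W > 0\<close> by simp
      show "w j / W \<ge> 0" "x j \<in> {0<..}" if "j \<in> K" for j
        using K(3)[OF that] \<open>W > 0\<close> by simp_all
    qed simp
    also have "\<dots> = W powr (p - 1) * (\<Sum>j\<in>K. w j * x j powr p)"
      using \<open>W > 0\<close> by (simp add: powr_diff sum_distrib_left)
    also have "\<dots> \<le> (\<Sum>j\<in>K. w j * x j powr p)"
    proof (rule mult_left_le_one_le)
      show "0 \<le> (\<Sum>j\<in>K. w j * x j powr p)"
        using K(2) w by (intro sum_nonneg mult_nonneg_nonneg) auto
      show "W powr (p - 1) \<le> 1"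
        using \<open>W > 0\<close> \<open>W \<le> 1\<close> p by (intro powr_le1) simp_all
    qed simp
    finally show ?thesis by (simp add: to_K)
  qed (simp add: to_K)
qed

lemma cmod_cinner_commute: "cmod (cinner x y) = cmod (cinner y x)"
  by (subst cinner_commute) simp

lemma bessel_product:
  assumes "finite I" "orthogonal_contractions I u" "orthogonal_contractions I w"
  shows "(\<Sum>i\<in>I. cmod (cinner x (u i)) * cmod (cinner y (w i))) \<le> norm x * norm y"
proof -
  have L2: "L2_set (\<lambda>i. cmod (cinner x (u i))) I \<le> norm x"
    if "orthogonal_contractions I u" for x u
    unfolding L2_set_def using bessel_inequality[OF assms(1) that] by (intro real_le_lsqrt) auto
  have "(\<Sum>i\<in>I. cmod (cinner x (u i)) * cmod (cinner y (w i)))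
      \<le> L2_set (\<lambda>i. cmod (cinner x (u i))) I * L2_set (\<lambda>i. cmod (cinner y (w i))) I"
    using L2_set_mult_ineq[of "\<lambda>i. cmod (cinner x (u i))" "\<lambda>i. cmod (cinner y (w i))" I] by simp
  also have "\<dots> \<le> norm x * norm y"
    using assms by (intro mult_mono L2) auto
  finally show ?thesis .
qed

text \<open>The matrix \<open>m\<close> is doubly substochastic by Bessel and Cauchy-Schwarz. Its
  row sums permit Jensen's inequality for each \<open>i\<close>; its column sums then remove the sum
  over \<open>i\<close>.\<close>

lemma sum_powr_diagonal_le:
  assumes I: "finite I" "orthogonal_contractions I e" "orthogonal_contractions I f"
    and J: "finite J" "orthogonal_contractions J u" "orthogonal_contractions J w"
    and T: "\<And>x y. cinner (T x) y = (\<Sum>j\<in>J. \<sigma> j * (cinner x (u j) * cinner (w j) y))"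
    and p: "p \<ge> 1"
  shows "(\<Sum>i\<in>I. cmod (cinner (T (e i)) (f i)) powr p) \<le> (\<Sum>j\<in>J. cmod (\<sigma> j) powr p)"
proof -
  define m where "m i j = cmod (cinner (e i) (u j)) * cmod (cinner (f i) (w j))" for i j
  have m_nonneg: "m i j \<ge> 0" for i j by (simp add: m_def)
  have row: "(\<Sum>j\<in>J. m i j) \<le> 1" if "i \<in> I" for i
  proof -
    have "(\<Sum>j\<in>J. m i j) \<le> norm (e i) * norm (f i)"
      unfolding m_def by (rule bessel_product[OF J])
    also have "\<dots> \<le> 1"
      using I(2,3) that by (intro mult_le_one) (auto simp: orthogonal_contractions_def)
    finally show ?thesis .
  qed
  have column: "(\<Sum>i\<in>I. m i j) \<le> 1" if "j \<in> J" for j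
  proof -
    have "(\<Sum>i\<in>I. m i j) \<le> norm (u j) * norm (w j)"
      unfolding m_def cmod_cinner_commute[of "e _"] cmod_cinner_commute[of "f _"]
      by (rule bessel_product[OF I])
    also have "\<dots> \<le> 1"
      using J(2,3) that by (intro mult_le_one) (auto simp: orthogonal_contractions_def)
    finally show ?thesis .
  qed
  have "(\<Sum>i\<in>I. cmod (cinner (T (e i)) (f i)) powr p)
      \<le> (\<Sum>i\<in>I. \<Sum>j\<in>J. m i j * cmod (\<sigma> j) powr p)"
  proof (rule sum_mono)
    fix i
    assume "i \<in> I"
    have "cmod (cinner (T (e i)) (f i)) \<le> (\<Sum>j\<in>J. m i j * cmod (\<sigma> j))"
      unfolding T m_def
      by (rule sum_norm_le) (simp add: norm_mult cmod_cinner_commute[of "f i"])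
    then have "cmod (cinner (T (e i)) (f i)) powr p \<le> (\<Sum>j\<in>J. m i j * cmod (\<sigma> j)) powr p"
      using p by (intro powr_mono2) auto
    also have "\<dots> \<le> (\<Sum>j\<in>J. m i j * cmod (\<sigma> j) powr p)"
      using J(1) m_nonneg row[OF \<open>i \<in> I\<close>] p by (intro powr_sum_le_sum_powr) auto
    finally show "cmod (cinner (T (e i)) (f i)) powr p \<le> (\<Sum>j\<in>J. m i j * cmod (\<sigma> j) powr p)" .
  qed
  also have "\<dots> = (\<Sum>j\<in>J. (\<Sum>i\<in>I. m i j) * cmod (\<sigma> j) powr p)"
    by (subst sum.swap) (simp add: sum_distrib_right)
  also have "\<dots> \<le> (\<Sum>j\<in>J. cmod (\<sigma> j) powr p)"
    using column m_nonneg by (intro sum_mono mult_left_le_one_le sum_nonneg) auto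
  finally show ?thesis .
qed

text \<open>Minkowski's inequality, as Jensen's inequality for the weights \<open>w k * c k / M\<close>.\<close>

lemma sum_powr_weighted_le:
  fixes w c :: "'k \<Rightarrow> real" and x :: "'k \<Rightarrow> 'i \<Rightarrow> real"
  assumes "finite K" and p: "p \<ge> 1"
    and w: "\<And>k. k \<in> K \<Longrightarrow> w k \<ge> 0" and c: "\<And>k. k \<in> K \<Longrightarrow> c k > 0"
    and x: "\<And>k i. k \<in> K \<Longrightarrow> i \<in> I \<Longrightarrow> x k i \<ge> 0"
    and x_le: "\<And>k. k \<in> K \<Longrightarrow> (\<Sum>i\<in>I. x k i powr p) \<le> c k powr p"
  shows "(\<Sum>i\<in>I. (\<Sum>k\<in>K. w k * x k i) powr p) \<le> (\<Sum>k\<in>K. w k * c k) powr p"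
proof -
  define M where "M = (\<Sum>k\<in>K. w k * c k)"
  have wc: "w k * c k \<ge> 0" if "k \<in> K" for k
    using w c that by (simp add: less_imp_le)
  have "M \<ge> 0" unfolding M_def by (intro sum_nonneg wc)
  show ?thesis
  proof (cases "M = 0")
    \<comment> \<open>The weights \<open>w k * c k / M\<close> do not exist here, but positivity of
      all \<open>c k\<close> forces every \<open>w k\<close> to vanish.\<close>
    case True
    then have "\<forall>k\<in>K. w k * c k = 0"
      unfolding M_def using assms(1) wc by (subst (asm) sum_nonneg_eq_0_iff) auto
    then have "w k = 0" if "k \<in> K" for k
      using c[OF that] that by auto
    then have "(\<Sum>k\<in>K. w k * x k i) = 0" for i
      by simp
    then show ?thesis by simp
  next
    case False
    with \<open>M \<ge> 0\<close> have "M > 0" by simp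
    have "(\<Sum>i\<in>I. (\<Sum>k\<in>K. w k * x k i) powr p)
        \<le> (\<Sum>i\<in>I. M powr p * (\<Sum>k\<in>K. w k * c k / M * (x k i / c k) powr p))"
    proof (rule sum_mono)
      fix i
      assume i: "i \<in> I"
      have "(\<Sum>k\<in>K. w k * x k i) = M * (\<Sum>k\<in>K. w k * c k / M * (x k i / c k))"
        unfolding sum_distrib_left using \<open>M > 0\<close>
        by (intro sum.cong refl) (auto dest: c)
      also have "\<dots> powr p = M powr p * (\<Sum>k\<in>K. w k * c k / M * (x k i / c k)) powr p"
        by (rule powr_mult)
      also have "\<dots> \<le> M powr p * (\<Sum>k\<in>K. w k * c k / M * (x k i / c k) powr p)"
      proof (intro mult_left_mono powr_sum_le_sum_powr assms(1) p)
        show "w k * c k / M \<ge> 0" if "k \<in> K" for k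
          using wc[OF that] \<open>M > 0\<close> by simp
        show "x k i / c k \<ge> 0" if "k \<in> K" for k
          using x[OF that i] c[OF that] by simp
        show "(\<Sum>k\<in>K. w k * c k / M) \<le> 1"
          unfolding sum_divide_distrib[symmetric] M_def[symmetric] using \<open>M > 0\<close> by simp
      qed simp
      finally show "(\<Sum>k\<in>K. w k * x k i) powr p
        \<le> M powr p * (\<Sum>k\<in>K. w k * c k / M * (x k i / c k) powr p)" .
    qed
    also have "\<dots> = M powr p * (\<Sum>k\<in>K. w k * c k / M * (\<Sum>i\<in>I. (x k i / c k) powr p))"
      unfolding sum_distrib_left[symmetric] by (subst sum.swap) (simp add: sum_distrib_left)
    also have "\<dots> \<le> M powr p * (\<Sum>k\<in>K. w k * c k / M * 1)"
    proof (intro mult_left_mono sum_mono)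
      fix k
      assume k: "k \<in> K"
      have "(\<Sum>i\<in>I. (x k i / c k) powr p) = (\<Sum>i\<in>I. x k i powr p) / c k powr p"
        unfolding sum_divide_distrib using x[OF k] c[OF k]
        by (intro sum.cong refl powr_divide)
      also have "\<dots> \<le> 1"
        using x_le[OF k] c[OF k] by simp
      finally show "(\<Sum>i\<in>I. (x k i / c k) powr p) \<le> 1" .
      show "w k * c k / M \<ge> 0"
        using wc[OF k] \<open>M > 0\<close> by simp
    qed simp
    also have "\<dots> = M powr p"
      using \<open>M > 0\<close> by (simp flip: sum_divide_distrib M_def)
    finally show ?thesis unfolding M_def .
  qed
qed

text \<open>The limit of the finite inequality along partial sums. Since \<open>p\<close> is
  positive and the partial sums are nonnegative, the power is continuous even where the limit is
  zero.\<close>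

lemma sum_powr_suminf_le:
  fixes w c :: "nat \<Rightarrow> real" and x :: "nat \<Rightarrow> 'i \<Rightarrow> real"
  assumes p: "p \<ge> 1" and w: "\<And>k. w k \<ge> 0" and c: "\<And>k. c k > 0"
    and x: "\<And>k i. i \<in> I \<Longrightarrow> x k i \<ge> 0"
    and x_le: "\<And>k. (\<Sum>i\<in>I. x k i powr p) \<le> c k powr p"
    and summable_x: "\<And>i. i \<in> I \<Longrightarrow> summable (\<lambda>k. w k * x k i)"
    and summable_c: "summable (\<lambda>k. w k * c k)"
  shows "(\<Sum>i\<in>I. (\<Sum>k. w k * x k i) powr p) \<le> (\<Sum>k. w k * c k) powr p"
proof (rule LIMSEQ_le)
  have partial: "(\<lambda>n. (\<Sum>k<n. g k) powr p) \<longlonglongrightarrow> (\<Sum>k. g k) powr p"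
    if "summable g" "\<And>k. g k \<ge> 0" for g :: "nat \<Rightarrow> real"
    using p that by (intro tendsto_powr' summable_LIMSEQ tendsto_const)
      (auto intro!: always_eventually sum_nonneg)
  show "(\<lambda>n. \<Sum>i\<in>I. (\<Sum>k<n. w k * x k i) powr p) \<longlonglongrightarrow> (\<Sum>i\<in>I. (\<Sum>k. w k * x k i) powr p)"
    using w x by (intro tendsto_sum partial summable_x) auto
  show "(\<lambda>n. (\<Sum>k<n. w k * c k) powr p) \<longlonglongrightarrow> (\<Sum>k. w k * c k) powr p"
    using w c by (intro partial summable_c) (simp add: less_imp_le)
  show "\<exists>N. \<forall>n\<ge>N. (\<Sum>i\<in>I. (\<Sum>k<n. w k * x k i) powr p) \<le> (\<Sum>k<n. w k * c k) powr p"
    using assms by (intro exI allI impI sum_powr_weighted_le) auto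
qed

section \<open>Singular values\<close>

lemma cinner_ext:
  assumes "\<And>z. cinner z x = cinner z y"
  shows "x = y"
  using assms[of "x - y"] cinner_self_eq_zero_iff[of "x - y"] by (simp add: cinner_diff_right)

text \<open>Gram-Schmidt, one vector at a time. Preserving the cardinality is the point: it turns a
  dimension, such as \<open>sing_mult\<close>, into a number of orthonormal vectors.\<close>

lemma orthonormal_of_independent:
  assumes "finite B" "ell2.independent B"
  shows "\<exists>C. finite C \<and> C \<subseteq> ell2.span B \<and> card C = card B \<and>
    (\<forall>c\<in>C. norm c = 1) \<and> (\<forall>c\<in>C. \<forall>d\<in>C. c \<noteq> d \<longrightarrow> cinner c d = 0)"
  using assms
proof (induction B rule: finite_induct)
  case (insert b B)
  then obtain C where C: "finite C" "C \<subseteq> ell2.span B" "card C = card B"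
    "\<And>c. c \<in> C \<Longrightarrow> norm c = 1" "\<And>c d. c \<in> C \<Longrightarrow> d \<in> C \<Longrightarrow> c \<noteq> d \<Longrightarrow> cinner c d = 0"
    by (metis ell2.independent_insert)
  define q where "q = (\<Sum>c\<in>C. cinner b c *\<^sub>C c)"
  define v where "v = b - q"
  have "q \<in> ell2.span B"
    unfolding q_def using C(2) by (intro ell2.span_sum ell2.span_scale) auto
  moreover have "b \<notin> ell2.span B"
    using insert.prems insert.hyps(2) by (metis ell2.independent_insert)
  ultimately have "v \<noteq> 0" by (auto simp: v_def)
  have orth: "cinner v c = 0" if "c \<in> C" for c
  proof -
    have "cinner q c = (\<Sum>d\<in>C. if d = c then cinner b c else 0)"
      unfolding q_def cinner_sum_left
      by (rule sum.cong) (auto simp: cinner_scale_left cinner_self C(4,5) that)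
    also have "\<dots> = cinner b c"
      using C(1) that by simp
    finally show ?thesis by (simp add: v_def cinner_diff_left)
  qed
  define u where "u = sgn v"
  have u: "norm u = 1" using \<open>v \<noteq> 0\<close> by (simp add: u_def norm_sgn)
  have u_orth: "cinner u c = 0" if "c \<in> C" for c
    using orth[OF that] by (simp add: u_def sgn_div_norm scaleR_eq_cscale cinner_scale_left)
  then have u_orth': "cinner c u = 0" if "c \<in> C" for c
    using that cinner_commute[of u c] by simp
  have "u \<notin> C"
    using u_orth[of u] u by (auto simp: cinner_self)
  have "u \<in> ell2.span (insert b B)"
    unfolding u_def sgn_div_norm scaleR_eq_cscale v_def
    using subsetD[OF ell2.span_mono[of B "insert b B"] \<open>q \<in> ell2.span B\<close>]
    by (intro ell2.span_scale ell2.span_diff) (auto intro: ell2.span_base)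
  moreover have "C \<subseteq> ell2.span (insert b B)"
    using C(2) ell2.span_mono[of B "insert b B"] by auto
  ultimately show ?case
    using C u u_orth u_orth' \<open>u \<notin> C\<close> insert.hyps
    by (intro exI[of _ "insert u C"]) auto
qed (auto intro: exI[of _ "{}"])

text \<open>Testing the eigenvalue equation against all vectors moves the adjoint to the other side,
  leaving a condition on \<open>T\<close> alone.\<close>

lemma in_sing_space_iff:
  assumes "\<And>x y. cinner (T x) y = cinner x (adjoint_op T y)"
  shows "x \<in> sing_space T s \<longleftrightarrow> (\<forall>y. cinner (T y) (T x) = complex_of_real (s\<^sup>2) * cinner y x)"
  unfolding sing_space_def mem_Collect_eq assms
  by (auto simp: cinner_scale_right intro!: cinner_ext)

lemma subspace_sing_space:
  assumes adj: "\<And>x y. cinner (T x) y = cinner x (adjoint_op T y)"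
    and "Vector_Spaces.linear cscale cscale T"
  shows "ell2.subspace (sing_space T s)"
proof -
  interpret T: Vector_Spaces.linear cscale cscale T by fact
  show ?thesis
    unfolding ell2.subspace_def
    by (auto simp: in_sing_space_iff[OF adj] T.zero T.add T.scale cinner_add_right
        cinner_scale_right algebra_simps)
qed

text \<open>For orthonormal eigenvectors \<open>c\<close> of \<open>T\<^sup>* T\<close> the vectors \<open>T c / s\<close> are orthonormal as well,
  and \<open>\<langle>T c, T c / s\<rangle> = s\<close>; so the singular values are diagonal entries of \<open>T\<close> along a pair of
  orthonormal systems.\<close>

lemma sum_sing_vals_le:
  assumes adj: "\<And>x y. cinner (T x) y = cinner x (adjoint_op T y)"
    and lin: "Vector_Spaces.linear cscale cscale T"
    and bound: "\<And>(I :: (real \<times> ell2) set) e f. finite I \<Longrightarrow> orthogonal_contractions I e \<Longrightarrow>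
      orthogonal_contractions I f \<Longrightarrow> (\<Sum>i\<in>I. cmod (cinner (T (e i)) (f i)) powr p) \<le> M"
    and F: "finite F" "F \<subseteq> sing_vals T"
  shows "(\<Sum>s\<in>F. real (sing_mult T s) * s powr p) \<le> M"
proof -
  have "\<exists>C. finite C \<and> C \<subseteq> sing_space T s \<and> card C = sing_mult T s \<and>
    (\<forall>c\<in>C. norm c = 1) \<and> (\<forall>c\<in>C. \<forall>d\<in>C. c \<noteq> d \<longrightarrow> cinner c d = 0)" for s
  \<comment> \<open>A nonzero dimension makes a basis finite. Dimension zero, which also stands for
    an infinite-dimensional space, is served by the empty set.\<close>
  proof (cases "sing_mult T s = 0")
    case False
    obtain B where B: "B \<subseteq> sing_space T s" "ell2.independent B" "card B = sing_mult T s"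
      unfolding sing_mult_def using ell2.basis_exists by metis
    then have "finite B" using False card_ge_0_finite by force
    moreover have "ell2.span B \<subseteq> sing_space T s"
      by (rule ell2.span_minimal[OF B(1) subspace_sing_space[OF adj lin]])
    ultimately show ?thesis
      using orthonormal_of_independent[of B] B(2,3) by (metis subset_trans)
  qed (auto intro: exI[of _ "{}"])
  then obtain C where C: "\<And>s. finite (C s)" "\<And>s. C s \<subseteq> sing_space T s"
    "\<And>s. card (C s) = sing_mult T s" "\<And>s c. c \<in> C s \<Longrightarrow> norm c = 1"
    "\<And>s c d. c \<in> C s \<Longrightarrow> d \<in> C s \<Longrightarrow> c \<noteq> d \<Longrightarrow> cinner c d = 0"
    by metis
  \<comment> \<open>Each index carries its singular value along with the vector, so that the
    normalisation in \<open>f\<close> can refer to it.\<close>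
  define I where "I = Sigma F C"
  define f where "f = (\<lambda>(s, c). complex_of_real (1 / s) *\<^sub>C T c)"
  have "finite I" using F(1) C(1) by (simp add: I_def)
  have pos: "s > 0" if "(s, c) \<in> I" for s c
    using that F(2) by (auto simp: I_def sing_vals_def)
  have TT: "cinner (T y) (T c) = complex_of_real (s\<^sup>2) * cinner y c" if "(s, c) \<in> I" for s c y
    using that subsetD[OF C(2), of c s] in_sing_space_iff[of T c s, OF adj] by (auto simp: I_def)
  have TT': "cinner (T c) (T y) = complex_of_real (s\<^sup>2) * cinner c y" if "(s, c) \<in> I" for s c y
    using arg_cong[OF TT[OF that, of y], of cnj] by (simp flip: cinner_commute)
  have orth: "cinner c d = 0" if "(s, c) \<in> I" "(t, d) \<in> I" "(s, c) \<noteq> (t, d)" for s c t d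
  proof (cases "s = t")
    case True
    with that C(5)[of c s d] show ?thesis by (auto simp: I_def)
  next
    case False
    \<comment> \<open>Both sides equal \<open>cinner (T c) (T d)\<close>, computed from the
      eigenvector property of \<open>c\<close> and of \<open>d\<close> respectively.\<close>
    have "complex_of_real (s\<^sup>2) * cinner c d = complex_of_real (t\<^sup>2) * cinner c d"
      using TT[OF that(2), of c] TT'[OF that(1), of d] by simp
    moreover have "s\<^sup>2 \<noteq> t\<^sup>2"
      using False pos[OF that(1)] pos[OF that(2)] by (simp add: power2_eq_iff)
    then have "complex_of_real (s\<^sup>2) \<noteq> complex_of_real (t\<^sup>2)"
      by (simp only: of_real_eq_iff not_False_eq_True)
    ultimately show ?thesis by (metis mult_cancel_right)
  qed
  have norm_T: "norm (T c) = s" if "(s, c) \<in> I" for s c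
  proof -
    have "norm c = 1" using that C(4) by (auto simp: I_def)
    then have "(norm (T c))\<^sup>2 = s\<^sup>2"
      using TT[OF that, of c] unfolding cinner_self of_real_mult[symmetric] of_real_eq_iff by simp
    then show ?thesis
      by (rule power2_eq_imp_eq) (simp_all add: less_imp_le pos[OF that])
  qed
  have "orthogonal_contractions I snd"
    unfolding orthogonal_contractions_def using orth C(4) by (fastforce simp: I_def)
  moreover have "orthogonal_contractions I f"
    unfolding orthogonal_contractions_def
  proof (intro conjI ballI impI)
    fix i j
    assume "i \<in> I" "j \<in> I" "i \<noteq> j"
    moreover obtain s c t d where "i = (s, c)" "j = (t, d)" by fastforce
    ultimately show "cinner (f i) (f j) = 0"
      using orth[of s c t d] by (simp add: f_def cinner_scale_left cinner_scale_right TT)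
  next
    fix i
    assume "i \<in> I"
    then show "norm (f i) \<le> 1"
      using norm_T pos by (cases i) (auto simp: f_def norm_cscale norm_divide abs_if)
  qed
  ultimately have "(\<Sum>i\<in>I. cmod (cinner (T (snd i)) (f i)) powr p) \<le> M"
    using \<open>finite I\<close> by (intro bound)
  also have "(\<Sum>i\<in>I. cmod (cinner (T (snd i)) (f i)) powr p) = (\<Sum>i\<in>I. fst i powr p)"
  proof (intro sum.cong refl)
    fix i
    assume i: "i \<in> I"
    obtain s c where sc: "i = (s, c)" by fastforce
    have "cinner (T c) (f i) = complex_of_real (1 / s * s\<^sup>2)"
      using i norm_T by (simp add: sc f_def cinner_scale_right cinner_self)
    also have "1 / s * s\<^sup>2 = s"
      using pos i by (simp add: sc power2_eq_square)
    finally show "cmod (cinner (T (snd i)) (f i)) powr p = fst i powr p"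
      using pos i by (simp add: sc less_imp_le)
  qed
  also have "\<dots> = (\<Sum>s\<in>F. \<Sum>c\<in>C s. s powr p)"
    unfolding I_def using F(1) C(1) by (subst sum.Sigma) (auto simp: case_prod_beta)
  also have "\<dots> = (\<Sum>s\<in>F. real (sing_mult T s) * s powr p)"
    by (simp add: C(3))
  finally show ?thesis .
qed

section \<open>The standard basis\<close>

lemma cinner_basis_vec_right: "cinner x (basis_vec n) = ell2_nth x n"
proof -
  have "(\<lambda>k. ell2_nth x k * cnj (ell2_nth (basis_vec n) k)) sums ell2_nth x n"
    using sums_single[of n "ell2_nth x"] by (simp add: basis_vec.rep_eq if_distrib cong: if_cong)
  then show ?thesis by (simp add: cinner_def sums_iff)
qed

lemma cinner_basis_vec: "cinner (basis_vec m) (basis_vec n) = (if n = m then 1 else 0)"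
  by (simp add: cinner_basis_vec_right basis_vec.rep_eq)

section \<open>The L-matrix of a single parameter\<close>

text \<open>The L-matrix whose only nonzero parameter is \<open>a\<^sub>k = 1\<close> has the eigenvalues
  \<open>1/2 \<plusminus> sqrt (k + 1/4)\<close>, the roots of \<open>x\<^sup>2 = x + k\<close>, with eigenvectors
  \<open>e\<^sub>0 + \<dots> + e\<^bsub>k-1\<^esub> + x e\<^sub>k\<close>.  Writing it through the unnormalised eigenvectors, whose squared
  norms are \<open>2 sqrt (k + 1/4) \<bar>x\<bar>\<close>, avoids an exception at \<open>k = 0\<close>, where the eigenvector of
  the eigenvalue \<open>0\<close> degenerates to the zero vector.\<close>

definition hook_vec :: "nat \<Rightarrow> real \<Rightarrow> ell2" where
  "hook_vec k r = (\<Sum>n<k. basis_vec n) + complex_of_real r *\<^sub>C basis_vec k"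

definition hook_root :: "nat \<Rightarrow> real" where
  "hook_root k = sqrt (real k + 1 / 4)"

definition hook_eigval :: "nat \<Rightarrow> bool \<Rightarrow> real" where
  "hook_eigval k b = 1 / 2 + (if b then 1 else - 1) * hook_root k"

abbreviation hook_eigvec :: "nat \<Rightarrow> bool \<Rightarrow> ell2" where
  "hook_eigvec k b \<equiv> hook_vec k (hook_eigval k b)"

text \<open>A spectral decomposition: for a nonzero eigenvector, the eigenvalue divided by the
  squared norm is \<open>1 / (2 * hook_root k)\<close> up to sign, which explains the common factor
  and the difference.\<close>

definition hook_op :: "nat \<Rightarrow> ell2 \<Rightarrow> ell2" where
  "hook_op k x = complex_of_real (1 / (2 * hook_root k)) *\<^sub>C
     (cinner x (hook_eigvec k True) *\<^sub>C hook_eigvec k True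
      - cinner x (hook_eigvec k False) *\<^sub>C hook_eigvec k False)"

lemma cinner_basis_vec_hook_vec:
  "cinner (basis_vec n) (hook_vec k r) = (if n < k then 1 else if n = k then complex_of_real r else 0)"
  by (simp add: hook_vec_def cinner_add_right cinner_sum_right cinner_scale_right cinner_basis_vec)

lemma cinner_hook_vec: "cinner (hook_vec k r) (hook_vec k s) = complex_of_real (real k + r * s)"
  by (subst (1) hook_vec_def)
    (simp add: cinner_add_left cinner_sum_left cinner_scale_left cinner_basis_vec_hook_vec)

lemma hook_root_ge: "hook_root k \<ge> 1 / 2"
  unfolding hook_root_def by (rule real_le_rsqrt) (simp add: power2_eq_square)

lemma hook_root_pos: "hook_root k > 0"
  using hook_root_ge[of k] by simp

lemma hook_root_squared: "(hook_root k)\<^sup>2 = real k + 1 / 4"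
  by (simp add: hook_root_def)

lemma abs_hook_eigval: "\<bar>hook_eigval k b\<bar> = hook_root k + (if b then 1 / 2 else - 1 / 2)"
  using hook_root_ge[of k] by (auto simp: hook_eigval_def)

text \<open>With r = \<open>hook_root k\<close> and k = r^2 - 1/4, the squared norm is 2 r^2 + r or
  2 r^2 - r, which factors as stated.\<close>

lemma norm_hook_eigvec: "(norm (hook_eigvec k b))\<^sup>2 = 2 * hook_root k * \<bar>hook_eigval k b\<bar>"
proof -
  have "complex_of_real ((norm (hook_eigvec k b))\<^sup>2)
      = complex_of_real (real k + hook_eigval k b * hook_eigval k b)"
    by (simp only: cinner_hook_vec flip: cinner_self)
  moreover have "real k + hook_eigval k b * hook_eigval k b = 2 * hook_root k * \<bar>hook_eigval k b\<bar>"
    using hook_root_squared[of k] unfolding abs_hook_eigval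
    by (cases b) (simp_all add: hook_eigval_def power2_eq_square algebra_simps)
  ultimately show ?thesis by (simp only: of_real_eq_iff)
qed

text \<open>The two roots of x^2 = x + k have product -k.\<close>

lemma hook_eigvec_orthogonal:
  assumes "b \<noteq> c"
  shows "cinner (hook_eigvec k b) (hook_eigvec k c) = 0"
proof -
  have "real k + hook_eigval k b * hook_eigval k c = 0"
    using hook_root_squared[of k] assms
    by (cases b; cases c) (simp_all add: hook_eigval_def power2_eq_square algebra_simps)
  then show ?thesis by (simp only: cinner_hook_vec of_real_0)
qed

lemma cinner_hook_op: "cinner (hook_op k x) y
  = complex_of_real (1 / (2 * hook_root k)) *
    (cinner x (hook_eigvec k True) * cinner (hook_eigvec k True) y
     - cinner x (hook_eigvec k False) * cinner (hook_eigvec k False) y)"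
  by (simp only: hook_op_def cinner_scale_left cinner_diff_left)

text \<open>Up to the factor \<open>1 / (2 * hook_root k)\<close>, an entry with both indices at
  most \<open>k\<close> is the difference of the i-th powers of the two eigenvalues, where i counts
  the indices equal to \<open>k\<close>. For i = 0, 1, 2 this gives 0, 1 and the sum of the
  eigenvalues, again 1.\<close>

lemma hook_op_entry:
  "cinner (hook_op k (basis_vec n)) (basis_vec m) = (if max m n = k then 1 else 0)"
proof -
  have vec: "cinner (hook_vec k r) (basis_vec m)
      = (if m < k then 1 else if m = k then complex_of_real r else 0)" for r
    by (subst cinner_commute) (simp add: cinner_basis_vec_hook_vec)
  define s where "s = complex_of_real (hook_root k)"
  have s: "s \<noteq> 0" using hook_root_pos[of k] by (simp add: s_def)
  consider "n < k" "m < k" | "n < k" "m = k" | "n = k" "m < k" | "n = k" "m = k" | "n > k \<or> m > k"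
    by linarith
  then show ?thesis
    using s unfolding cinner_hook_op vec cinner_basis_vec_hook_vec
    by cases (auto simp: hook_eigval_def max_def field_simps simp flip: s_def)
qed

lemma hook_op_add: "hook_op k (x + y) = hook_op k x + hook_op k y"
  by (simp add: hook_op_def cinner_add_left ell2.scale_left_distrib ell2.scale_right_distrib
      ell2.scale_right_diff_distrib)

lemma hook_op_scale: "hook_op k (c *\<^sub>C x) = c *\<^sub>C hook_op k x"
  by (simp add: hook_op_def cinner_scale_left ell2.scale_right_diff_distrib mult.left_commute
      mult.assoc)

lemma hook_op_selfadjoint: "cinner (hook_op k x) y = cinner x (hook_op k y)"
proof -
  have "cinner x (hook_op k y) = cnj (cinner (hook_op k y) x)"
    by (rule cinner_commute)
  also have "\<dots> = cinner (hook_op k x) y"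
    unfolding cinner_hook_op by (simp add: mult.commute flip: cinner_commute)
  finally show ?thesis ..
qed

text \<open>A crude triangle-inequality bound; its order \<open>hook_root k\<close> is all that
  convergence of the series for \<open>L_op\<close> requires.\<close>

lemma norm_hook_op_le: "norm (hook_op k x) \<le> 2 * hook_root k * norm x"
proof -
  define v where "v = hook_eigvec k"
  define s where "s = hook_root k"
  have s: "s > 0" by (simp add: s_def hook_root_pos)
  have "norm (hook_op k x)
      = 1 / (2 * s) * norm (cinner x (v True) *\<^sub>C v True - cinner x (v False) *\<^sub>C v False)"
    using s by (simp add: hook_op_def norm_cscale norm_divide norm_mult v_def s_def)
  also have "\<dots> \<le> 1 / (2 * s) *
      (norm x * norm (v True) * norm (v True) + norm x * norm (v False) * norm (v False))"
    using s by (intro mult_left_mono order_trans[OF norm_triangle_ineq4] add_mono)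
      (auto simp: norm_cscale intro!: mult_right_mono cmod_cinner_le)
  also have "\<dots> = 1 / (2 * s) * (norm x * ((norm (v True))\<^sup>2 + (norm (v False))\<^sup>2))"
    by (simp add: power2_eq_square algebra_simps)
  also have "(norm (v True))\<^sup>2 + (norm (v False))\<^sup>2 = 2 * s * (2 * s)"
    unfolding v_def norm_hook_eigvec abs_hook_eigval s_def by (simp add: algebra_simps)
  also have "1 / (2 * s) * (norm x * (2 * s * (2 * s))) = 2 * s * norm x"
    using s by simp
  finally show ?thesis by (simp add: s_def)
qed

text \<open>The normalised form demanded by \<open>sum_powr_diagonal_le\<close>. Where an
  eigenvector vanishes, so does its \<open>sgn\<close>, and both sides of the termwise identity are
  zero.\<close>

lemma hook_op_diagonal:
  "cinner (hook_op k x) y = (\<Sum>b\<in>UNIV. complex_of_real (hook_eigval k b) *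
     (cinner x (sgn (hook_eigvec k b)) * cinner (sgn (hook_eigvec k b)) y))"
proof -
  have "complex_of_real (hook_eigval k b) *
      (cinner x (sgn (hook_eigvec k b)) * cinner (sgn (hook_eigvec k b)) y)
    = complex_of_real ((if b then 1 else - 1) / (2 * hook_root k)) *
      (cinner x (hook_eigvec k b) * cinner (hook_eigvec k b) y)" for b
  proof (cases "hook_eigvec k b = 0")
    case False
    define v where "v = hook_eigvec k b"
    have v: "norm v > 0" using False by (simp add: v_def)
    \<comment> \<open>By \<open>norm_hook_eigvec\<close> a nonzero eigenvector has a nonzero
      eigenvalue, so its absolute value can be cancelled below.\<close>
    then have "0 < 2 * hook_root k * \<bar>hook_eigval k b\<bar>"
      unfolding v_def by (simp flip: norm_hook_eigvec)
    then have "\<bar>hook_eigval k b\<bar> > 0"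
      by (auto simp: zero_less_mult_iff)
    then have eigval: "hook_eigval k b = (if b then 1 else - 1) * \<bar>hook_eigval k b\<bar>"
      using hook_root_pos[of k] by (auto simp: abs_hook_eigval) (auto simp: hook_eigval_def)
    have "hook_eigval k b / (norm v)\<^sup>2 = (if b then 1 else - 1) / (2 * hook_root k)"
      unfolding v_def norm_hook_eigvec using \<open>\<bar>hook_eigval k b\<bar> > 0\<close>
      by (subst eigval) simp
    moreover have "complex_of_real (hook_eigval k b) * (cinner x (sgn v) * cinner (sgn v) y)
        = complex_of_real (hook_eigval k b / (norm v)\<^sup>2) * (cinner x v * cinner v y)"
      by (simp add: sgn_div_norm scaleR_eq_cscale cinner_scale_left cinner_scale_right
          divide_inverse power2_eq_square)
    ultimately show ?thesis by (simp add: v_def)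
  qed simp
  then show ?thesis
    unfolding cinner_hook_op by (simp add: UNIV_bool algebra_simps)
qed

section \<open>Power sums of the single-parameter operators\<close>

lemma mu_eq_eigval_squared:
  "mu_plus k = (hook_eigval k True)\<^sup>2" "mu_minus k = (hook_eigval k False)\<^sup>2"
  using hook_root_squared[of k]
  by (simp_all add: mu_plus_def mu_minus_def hook_eigval_def power2_eq_square algebra_simps
      flip: hook_root_def)

lemma abs_powr_eq_square_powr_half: "\<bar>x\<bar> powr p = (x\<^sup>2) powr (p / 2)" for x p :: real
proof -
  have "\<bar>x\<bar> = (x\<^sup>2) powr (1 / 2)"
    by (simp add: powr_half_sqrt)
  then show ?thesis
    by (simp only: powr_powr) simp
qed

lemma orthogonal_contractions_hook: "orthogonal_contractions UNIV (\<lambda>b. sgn (hook_eigvec k b))"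
  unfolding orthogonal_contractions_def
proof (intro conjI ballI impI)
  show "norm (sgn (hook_eigvec k b)) \<le> 1" for b
    by (simp add: norm_sgn)
  show "cinner (sgn (hook_eigvec k b)) (sgn (hook_eigvec k c)) = 0" if "b \<noteq> c" for b c
    by (simp add: sgn_div_norm scaleR_eq_cscale cinner_scale_left cinner_scale_right
        hook_eigvec_orthogonal[OF that])
qed

lemma sum_powr_hook_op_le:
  assumes "finite I" "orthogonal_contractions I e" "orthogonal_contractions I f" "p \<ge> 1"
  shows "(\<Sum>i\<in>I. cmod (cinner (hook_op k (e i)) (f i)) powr p)
    \<le> mu_plus k powr (p / 2) + mu_minus k powr (p / 2)"
  using sum_powr_diagonal_le[OF assms(1-3) finite orthogonal_contractions_hook
      orthogonal_contractions_hook hook_op_diagonal assms(4), of k]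
  by (simp add: UNIV_bool mu_eq_eigval_squared abs_powr_eq_square_powr_half add.commute)

text \<open>Minkowski's inequality above divides by these constants, so strict positivity is
  required, also at \<open>k = 0\<close> where \<open>mu_minus\<close> vanishes.\<close>

lemma schatten_hook_pos:
  "(mu_plus k powr (p / 2) + mu_minus k powr (p / 2)) powr (1 / p) > 0"
proof -
  have "mu_plus k > 0"
    using hook_root_pos[of k] by (simp add: mu_eq_eigval_squared hook_eigval_def)
  then have "mu_plus k powr (p / 2) > 0" by simp
  then have "mu_plus k powr (p / 2) + mu_minus k powr (p / 2) > 0"
    by (intro add_pos_nonneg) auto
  then show ?thesis by simp
qed

text \<open>Both eigenvalues are at most \<open>2 * hook_root k\<close> in absolute value and
  \<open>2 powr (1 / p)\<close> is at most 2. One summability condition therefore serves all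
  \<open>p\<close>.\<close>

lemma schatten_hook_le:
  assumes "p \<ge> 1"
  shows "(mu_plus k powr (p / 2) + mu_minus k powr (p / 2)) powr (1 / p) \<le> 4 * hook_root k"
proof -
  have eigval: "\<bar>hook_eigval k b\<bar> powr p \<le> (2 * hook_root k) powr p" for b
    using hook_root_ge[of k] assms by (intro powr_mono2) (auto simp: abs_hook_eigval)
  have "(mu_plus k powr (p / 2) + mu_minus k powr (p / 2)) powr (1 / p)
      \<le> (2 * (2 * hook_root k) powr p) powr (1 / p)"
    using eigval[of True] eigval[of False] assms
    by (intro powr_mono2) (auto simp: mu_eq_eigval_squared abs_powr_eq_square_powr_half)
  also have "\<dots> = 2 powr (1 / p) * (2 * hook_root k)"
    using assms hook_root_pos[of k] by (simp add: powr_mult powr_powr)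
  also have "2 powr (1 / p) \<le> (2 powr 1 :: real)"
    using assms by (intro powr_mono) auto
  then have "2 powr (1 / p) * (2 * hook_root k) \<le> 2 * (2 * hook_root k)"
    using hook_root_pos[of k] by (intro mult_right_mono) auto
  finally show ?thesis by simp
qed

section \<open>Continuity and compactness\<close>

lemma bounded_linear_cinner_left: "bounded_linear (\<lambda>x. cinner x y)"
  by (rule bounded_linear_intro[where K = "norm y"])
    (simp_all add: cinner_add_left scaleR_eq_cscale cinner_scale_left cmod_cinner_le
      scaleR_conv_of_real)

lemma bounded_linear_cscale_right: "bounded_linear (\<lambda>x. c *\<^sub>C x)"
  by (rule bounded_linear_intro[where K = "cmod c"])
    (simp_all add: ell2.scale_right_distrib scaleR_eq_cscale norm_cscale mult.commute)

lemma bounded_linear_cscale_left: "bounded_linear (\<lambda>c. c *\<^sub>C x)"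
  by (rule bounded_linear_intro[where K = "norm x"])
    (simp_all add: ell2.scale_left_distrib scaleR_eq_cscale norm_cscale scaleR_conv_of_real)

text \<open>A finite net of an approximating compact set is a net of \<open>closure S\<close>, with
  one third of \<open>e\<close> spent on each of closure, approximation and net.\<close>

lemma compact_closure_approx:
  fixes S :: "'a::complete_space set"
  assumes "\<And>e. e > 0 \<Longrightarrow> \<exists>C. compact C \<and> (\<forall>x\<in>S. \<exists>y\<in>C. dist x y < e)"
  shows "compact (closure S)"
  unfolding compact_eq_totally_bounded
proof (intro conjI allI impI)
  fix e :: real
  assume "e > 0"
  then obtain C where C: "compact C" "\<And>x. x \<in> S \<Longrightarrow> \<exists>y\<in>C. dist x y < e / 3"
    using assms[of "e / 3"] by auto
  obtain K where K: "finite K" "C \<subseteq> (\<Union>z\<in>K. ball z (e / 3))"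
    using C(1) \<open>e > 0\<close> unfolding compact_eq_totally_bounded by (metis divide_pos_pos zero_less_numeral)
  have "closure S \<subseteq> (\<Union>z\<in>K. ball z e)"
  proof
    fix x
    assume "x \<in> closure S"
    then obtain x' where x': "x' \<in> S" "dist x' x < e / 3"
      using \<open>e > 0\<close> unfolding closure_approachable by (metis divide_pos_pos zero_less_numeral)
    obtain y where y: "y \<in> C" "dist x' y < e / 3"
      using C(2) x'(1) by blast
    obtain z where z: "z \<in> K" "dist z y < e / 3"
      using K(2) y(1) by auto
    have "dist z x < e"
      using dist_triangle[of z x y] dist_triangle[of y x x'] x'(2) y(2) z(2)
      by (simp add: dist_commute)
    with z(1) show "x \<in> (\<Union>z\<in>K. ball z e)" by auto
  qed
  with K(1) show "\<exists>K. finite K \<and> closure S \<subseteq> (\<Union>z\<in>K. ball z e)" by blast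
qed (simp add: complete_eq_closed)

text \<open>The operator factors through its two coefficients, which range over a product of closed
  discs when \<open>x\<close> ranges over the unit ball.\<close>

lemma hook_op_compact: "\<exists>C. compact C \<and> hook_op k ` cball 0 1 \<subseteq> C"
proof -
  define v where "v = hook_eigvec k"
  define g where "g = (\<lambda>(c, d).
    complex_of_real (1 / (2 * hook_root k)) *\<^sub>C (c *\<^sub>C v True - d *\<^sub>C v False))"
  define D where "D = cball (0 :: complex) (norm (v True)) \<times> cball (0 :: complex) (norm (v False))"
  have "continuous_on D g"
    unfolding g_def case_prod_beta
    by (intro bounded_linear.continuous_on[OF bounded_linear_cscale_right]
        bounded_linear.continuous_on[OF bounded_linear_cscale_left] continuous_intros)
  then have "compact (g ` D)"
    by (intro compact_continuous_image) (simp_all add: D_def compact_Times)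
  moreover have "hook_op k x \<in> g ` D" if "norm x \<le> 1" for x
  proof
    show "hook_op k x = g (cinner x (v True), cinner x (v False))"
      by (simp add: hook_op_def g_def v_def)
    have "cmod (cinner x w) \<le> norm w" for w
      using cmod_cinner_le[of x w] mult_right_mono[OF that, of "norm w"] by simp
    then show "(cinner x (v True), cinner x (v False)) \<in> D"
      by (simp add: D_def)
  qed
  ultimately show ?thesis by (intro exI[of _ "g ` D"]) auto
qed

section \<open>L-operators\<close>

definition L_op :: "(nat \<Rightarrow> complex) \<Rightarrow> ell2 \<Rightarrow> ell2" where
  "L_op a x = (\<Sum>k. a k *\<^sub>C hook_op k x)"

context
  fixes a :: "nat \<Rightarrow> complex"
  assumes summable_a: "summable (\<lambda>k. cmod (a k) * hook_root k)"
begin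

lemma norm_L_op_term_le: "norm (a k *\<^sub>C hook_op k x) \<le> cmod (a k) * hook_root k * (2 * norm x)"
  using mult_left_mono[OF norm_hook_op_le[of k x], of "cmod (a k)"]
  by (simp add: norm_cscale mult_ac)

lemma summable_norm_L_op: "summable (\<lambda>k. norm (a k *\<^sub>C hook_op k x))"
  by (rule summable_comparison_test'[OF summable_mult2[OF summable_a, of "2 * norm x"], of 0])
    (simp add: norm_L_op_term_le)

lemma summable_L_op: "summable (\<lambda>k. a k *\<^sub>C hook_op k x)"
  by (rule summable_norm_cancel[OF summable_norm_L_op])

lemma linear_L_op: "Vector_Spaces.linear cscale cscale (L_op a)"
  unfolding Vector_Spaces.linear_iff
proof (intro conjI allI ell2.vector_space_axioms)
  show "L_op a (x + y) = L_op a x + L_op a y" for x y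
    unfolding L_op_def suminf_add[OF summable_L_op summable_L_op]
    by (simp add: hook_op_add ell2.scale_right_distrib)
  show "L_op a (c *\<^sub>C x) = c *\<^sub>C L_op a x" for c x
    unfolding L_op_def bounded_linear.suminf[OF bounded_linear_cscale_right summable_L_op]
    by (simp add: hook_op_scale mult.commute)
qed

text \<open>A tail estimate uniform on the unit ball: \<open>n = 0\<close> gives boundedness, large
  \<open>n\<close> the approximation behind compactness.\<close>

lemma norm_L_op_diff_le:
  "norm (L_op a x - (\<Sum>k<n. a k *\<^sub>C hook_op k x))
    \<le> (\<Sum>k. cmod (a (k + n)) * hook_root (k + n)) * (2 * norm x)"
proof -
  have "L_op a x - (\<Sum>k<n. a k *\<^sub>C hook_op k x) = (\<Sum>k. a (k + n) *\<^sub>C hook_op (k + n) x)"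
    unfolding L_op_def suminf_minus_initial_segment[OF summable_L_op] ..
  also have "norm \<dots> \<le> (\<Sum>k. norm (a (k + n) *\<^sub>C hook_op (k + n) x))"
    by (rule summable_norm[OF summable_ignore_initial_segment[OF summable_norm_L_op]])
  also have "\<dots> \<le> (\<Sum>k. cmod (a (k + n)) * hook_root (k + n) * (2 * norm x))"
    by (intro suminf_le norm_L_op_term_le summable_mult2
        summable_ignore_initial_segment[OF summable_norm_L_op]
        summable_ignore_initial_segment[OF summable_a])
  also have "\<dots> = (\<Sum>k. cmod (a (k + n)) * hook_root (k + n)) * (2 * norm x)"
    by (rule suminf_mult2[OF summable_ignore_initial_segment[OF summable_a], symmetric])
  finally show ?thesis .
qed

lemma bounded_L_op: "bounded_op (L_op a)"
  unfolding bounded_op_def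
proof (intro conjI linear_L_op exI allI)
  show "norm (L_op a x) \<le> (\<Sum>k. cmod (a k) * hook_root k) * 2 * norm x" for x
    using norm_L_op_diff_le[of x 0] by simp
qed

lemma compact_L_op: "compact_op (L_op a)"
  unfolding compact_op_def
proof (intro conjI bounded_L_op compact_closure_approx)
  fix e :: real
  assume "e > 0"
  have "(\<lambda>n. \<Sum>k. cmod (a (k + n)) * hook_root (k + n)) \<longlonglongrightarrow> 0"
    by (rule suminf_exist_split2[OF summable_a])
  then obtain n where "\<bar>\<Sum>k. cmod (a (k + n)) * hook_root (k + n)\<bar> < e / 2"
    using LIMSEQ_D[of _ 0 "e / 2"] \<open>e > 0\<close> by fastforce
  then have n: "(\<Sum>k. cmod (a (k + n)) * hook_root (k + n)) * 2 < e" by simp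
  \<comment> \<open>Finite partial sums map the ball into a compact set, as sums and scalar
    multiples of compact sets are compact.\<close>
  have "\<exists>C. compact C \<and> (\<lambda>x. \<Sum>k<m. a k *\<^sub>C hook_op k x) ` cball 0 1 \<subseteq> C" for m
  proof (induction m)
    case 0
    show ?case by (intro exI[of _ "{0}"]) auto
  next
    case (Suc m)
    then obtain C where C: "compact C" "(\<lambda>x. \<Sum>k<m. a k *\<^sub>C hook_op k x) ` cball 0 1 \<subseteq> C"
      by blast
    obtain D where D: "compact D" "hook_op m ` cball 0 1 \<subseteq> D"
      using hook_op_compact by blast
    have "compact ((\<lambda>x. a m *\<^sub>C x) ` D)"
      by (intro compact_continuous_image D(1)
          bounded_linear.continuous_on[OF bounded_linear_cscale_right]
          continuous_on_id)
    then have "compact {x + y |x y. x \<in> C \<and> y \<in> (\<lambda>x. a m *\<^sub>C x) ` D}"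
      by (rule compact_sums[OF C(1)])
    moreover have "(\<Sum>k<Suc m. a k *\<^sub>C hook_op k x) \<in> {x + y |x y. x \<in> C \<and> y \<in> (\<lambda>x. a m *\<^sub>C x) ` D}"
      if "x \<in> cball 0 1" for x
    proof -
      have "(\<Sum>k<m. a k *\<^sub>C hook_op k x) \<in> C" "a m *\<^sub>C hook_op m x \<in> (\<lambda>x. a m *\<^sub>C x) ` D"
        using C(2) D(2) that by (auto simp: image_subset_iff)
      then show ?thesis by auto
    qed
    ultimately show ?case by blast
  qed
  then obtain C where C: "compact C" "(\<lambda>x. \<Sum>k<n. a k *\<^sub>C hook_op k x) ` cball 0 1 \<subseteq> C"
    by blast
  have "dist (L_op a x) (\<Sum>k<n. a k *\<^sub>C hook_op k x) < e" if "norm x \<le> 1" for x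
  proof -
    have "0 \<le> (\<Sum>k. cmod (a (k + n)) * hook_root (k + n))"
      using hook_root_pos
      by (intro suminf_nonneg summable_ignore_initial_segment[OF summable_a])
        (simp add: less_imp_le)
    then have "(\<Sum>k. cmod (a (k + n)) * hook_root (k + n)) * (2 * norm x)
        \<le> (\<Sum>k. cmod (a (k + n)) * hook_root (k + n)) * 2"
      using that by (intro mult_left_mono) auto
    then show ?thesis
      using norm_L_op_diff_le[of x n] n unfolding dist_norm by linarith
  qed
  then show "\<exists>C. compact C \<and> (\<forall>y\<in>L_op a ` cball 0 1. \<exists>z\<in>C. dist y z < e)"
    using C by (intro exI[of _ C]) (fastforce simp: image_subset_iff)
qed

lemma cinner_L_op: "cinner (L_op a x) y = (\<Sum>k. a k * cinner (hook_op k x) y)"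
  unfolding L_op_def bounded_linear.suminf[OF bounded_linear_cinner_left summable_L_op]
  by (simp add: cinner_scale_left)

lemma summable_cinner_L_op: "summable (\<lambda>k. a k * cinner (hook_op k x) y)"
  using bounded_linear.summable[OF bounded_linear_cinner_left summable_L_op, of x y]
  by (simp add: cinner_scale_left)

lemma L_op_represents: "matrix_represents (L_matrix a) (L_op a)"
  unfolding matrix_represents_def cinner_L_op hook_op_entry L_matrix_def
proof (intro allI)
  fix m n :: nat
  have "(\<Sum>k. a k * (if max m n = k then 1 else 0)) = (\<Sum>k. if k = max m n then a k else 0)"
    by (rule arg_cong[where f = suminf]) auto
  also have "\<dots> = a (max m n)"
    by (rule sums_unique[OF sums_single, symmetric])
  finally show "(\<Sum>k. a k * (if max m n = k then 1 else 0)) = a (max m n)" .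
qed

end

text \<open>Termwise self-adjointness of \<open>hook_op\<close>. Placed outside the context because
  its facts are applied both to \<open>a\<close> and to the conjugate sequence.\<close>

lemma cinner_L_op_cnj:
  assumes "summable (\<lambda>k. cmod (a k) * hook_root k)"
  shows "cinner (L_op a x) y = cinner x (L_op (\<lambda>k. cnj (a k)) y)"
proof -
  have cnj_a: "summable (\<lambda>k. cmod (cnj (a k)) * hook_root k)"
    using assms by simp
  have "(\<lambda>k. cnj (a k * cinner (hook_op k x) y)) sums cnj (cinner (L_op a x) y)"
    unfolding cinner_L_op[OF assms]
    by (rule sums_cnj[THEN iffD2, OF summable_sums[OF summable_cinner_L_op[OF assms]]])
  moreover have "(\<lambda>k. cnj (a k * cinner (hook_op k x) y))
      = (\<lambda>k. cnj (a k) * cinner (hook_op k y) x)"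
    by (rule ext) (simp add: hook_op_selfadjoint flip: cinner_commute)
  moreover have "(\<lambda>k. cnj (a k) * cinner (hook_op k y) x)
      sums cinner (L_op (\<lambda>k. cnj (a k)) y) x"
    unfolding cinner_L_op[OF cnj_a] by (rule summable_sums[OF summable_cinner_L_op[OF cnj_a]])
  ultimately have "cnj (cinner (L_op a x) y) = cinner (L_op (\<lambda>k. cnj (a k)) y) x"
    by (metis sums_unique2)
  then show ?thesis
    by (metis cinner_commute complex_cnj_cnj)
qed

section \<open>Adjoint and Schatten norms of L-operators\<close>

context
  fixes a :: "nat \<Rightarrow> complex"
  assumes summable_a: "summable (\<lambda>k. cmod (a k) * hook_root k)"
begin

text \<open>Since \<open>adjoint_op\<close> is a definite description, its value is settled by
  exhibiting the operator with conjugate parameters and proving uniqueness with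
  \<open>cinner_ext\<close>.\<close>

lemma adjoint_L_op: "cinner (L_op a x) y = cinner x (adjoint_op (L_op a) y)"
proof -
  have "adjoint_op (L_op a) = L_op (\<lambda>k. cnj (a k))"
    unfolding adjoint_op_def
  proof (rule the_equality)
    show "\<forall>x y. cinner (L_op a x) y = cinner x (L_op (\<lambda>k. cnj (a k)) y)"
      using cinner_L_op_cnj[OF summable_a] by blast
    show "S = L_op (\<lambda>k. cnj (a k))" if "\<forall>x y. cinner (L_op a x) y = cinner x (S y)" for S
      using that by (intro ext cinner_ext) (simp flip: cinner_L_op_cnj[OF summable_a])
  qed
  then show ?thesis by (simp add: cinner_L_op_cnj[OF summable_a])
qed

lemma summable_schatten_bound:
  assumes "p \<ge> 1"
  shows "summable (\<lambda>k. cmod (a k) *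
    (mu_plus k powr (p / 2) + mu_minus k powr (p / 2)) powr (1 / p))"
proof (rule summable_comparison_test'[OF summable_mult2[OF summable_a, of 4], of 0])
  show "norm (cmod (a k) * (mu_plus k powr (p / 2) + mu_minus k powr (p / 2)) powr (1 / p))
      \<le> cmod (a k) * hook_root k * 4" for k
    using mult_left_mono[OF schatten_hook_le[OF assms, of k], of "cmod (a k)"]
    by (simp add: abs_mult)
qed

text \<open>Minkowski's inequality with weights \<open>cmod (a k)\<close>, where \<open>c k\<close>
  bounds the diagonal sums of \<open>hook_op k\<close>.\<close>

lemma sum_powr_L_op_le:
  assumes I: "finite I" "orthogonal_contractions I e" "orthogonal_contractions I f" and p: "p \<ge> 1"
  defines "c \<equiv> \<lambda>k. (mu_plus k powr (p / 2) + mu_minus k powr (p / 2)) powr (1 / p)"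
  shows "(\<Sum>i\<in>I. cmod (cinner (L_op a (e i)) (f i)) powr p) \<le> (\<Sum>k. cmod (a k) * c k) powr p"
proof -
  have abs_summable: "summable (\<lambda>k. cmod (a k) * cmod (cinner (hook_op k x) y))" for x y
  proof (rule summable_comparison_test'[where N = 0,
        OF summable_mult2[OF summable_norm_L_op[OF summable_a, of x], of "norm y"]])
    show "norm (cmod (a k) * cmod (cinner (hook_op k x) y)) \<le> norm (a k *\<^sub>C hook_op k x) * norm y"
      for k
      using cmod_cinner_le[of "a k *\<^sub>C hook_op k x" y]
      by (simp add: cinner_scale_left norm_mult)
  qed
  have "(\<Sum>i\<in>I. cmod (cinner (L_op a (e i)) (f i)) powr p)
      \<le> (\<Sum>i\<in>I. (\<Sum>k. cmod (a k) * cmod (cinner (hook_op k (e i)) (f i))) powr p)"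
  proof (intro sum_mono powr_mono2)
    show "cmod (cinner (L_op a x) y) \<le> (\<Sum>k. cmod (a k) * cmod (cinner (hook_op k x) y))" for x y
      unfolding cinner_L_op[OF summable_a]
      using summable_norm[of "\<lambda>k. a k * cinner (hook_op k x) y"] abs_summable[of x y]
      by (simp add: norm_mult)
  qed (use p in simp_all)
  also have "\<dots> \<le> (\<Sum>k. cmod (a k) * c k) powr p"
  proof (rule sum_powr_suminf_le[OF p])
    show "c k > 0" for k
      unfolding c_def by (rule schatten_hook_pos)
    show "(\<Sum>i\<in>I. cmod (cinner (hook_op k (e i)) (f i)) powr p) \<le> c k powr p" for k
      using sum_powr_hook_op_le[OF I p, of k] p by (simp add: c_def powr_powr)
    show "summable (\<lambda>k. cmod (a k) * c k)"
      unfolding c_def by (rule summable_schatten_bound[OF p])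
  qed (simp_all add: abs_summable)
  finally show ?thesis .
qed

text \<open>The uniform bound \<open>M powr p\<close> on finite sums over singular values yields
  both summability and the norm estimate.\<close>

lemma L_op_schatten:
  assumes p: "p \<ge> 1"
  shows "L_op a \<in> schatten_class p"
    and "schatten_norm p (L_op a)
      \<le> (\<Sum>k. cmod (a k) * (mu_plus k powr (p / 2) + mu_minus k powr (p / 2)) powr (1 / p))"
proof -
  define M where
    "M = (\<Sum>k. cmod (a k) * (mu_plus k powr (p / 2) + mu_minus k powr (p / 2)) powr (1 / p))"
  let ?g = "\<lambda>s. real (sing_mult (L_op a) s) * s powr p"
  have bound: "sum ?g F \<le> M powr p" if "finite F" "F \<subseteq> sing_vals (L_op a)" for F
    unfolding M_def using that
    by (intro sum_sing_vals_le adjoint_L_op linear_L_op[OF summable_a] sum_powr_L_op_le p)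
  have summable: "?g summable_on sing_vals (L_op a)"
    using bound by (intro nonneg_bdd_above_summable_on) (auto intro!: bdd_aboveI[of _ "M powr p"])
  then show "L_op a \<in> schatten_class p"
    by (simp add: schatten_class_def compact_L_op[OF summable_a])
  have "M \<ge> 0"
    unfolding M_def by (intro suminf_nonneg summable_schatten_bound p) simp
  have "schatten_norm p (L_op a) \<le> (M powr p) powr (1 / p)"
    unfolding schatten_norm_def using p
    by (intro powr_mono2 infsum_le_finite_sums summable bound infsum_nonneg) auto
  also have "\<dots> = M"
    using p \<open>M \<ge> 0\<close> by (simp add: powr_powr)
  finally show "schatten_norm p (L_op a)
      \<le> (\<Sum>k. cmod (a k) * (mu_plus k powr (p / 2) + mu_minus k powr (p / 2)) powr (1 / p))"
    unfolding M_def .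
qed

end

text \<open>From index one on, k + 1/4 is at most 4 k; at index zero no multiple of sqrt k would
  do.\<close>

lemma hook_root_Suc_le: "hook_root (Suc k) \<le> 2 * sqrt (real (Suc k))"
proof -
  have "hook_root (Suc k) \<le> sqrt (4 * real (Suc k))"
    unfolding hook_root_def by (intro real_sqrt_le_mono) simp
  then show ?thesis unfolding real_sqrt_mult by simp
qed

theorem theorem11:
  fixes a :: "nat \<Rightarrow> complex"
  assumes "summable (\<lambda>k. sqrt (real (Suc k)) * cmod (a (Suc k)))"
  shows "\<exists>L. matrix_represents (L_matrix a) L \<and> L \<in> trace_class \<and>
    (\<forall>p\<ge>1. L \<in> schatten_class p \<and>
      schatten_norm p L
        \<le> (\<Sum>k. cmod (a k) * (mu_plus k powr (p / 2) + mu_minus k powr (p / 2)) powr (1 / p)))"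
proof -
  have "summable (\<lambda>k. cmod (a (Suc k)) * hook_root (Suc k))"
  proof (rule summable_comparison_test'[OF summable_mult[OF assms, of 2], of 0])
    show "norm (cmod (a (Suc k)) * hook_root (Suc k))
        \<le> 2 * (sqrt (real (Suc k)) * cmod (a (Suc k)))" for k
      using mult_left_mono[OF hook_root_Suc_le[of k], of "cmod (a (Suc k))"] hook_root_pos[of "Suc k"]
      by (simp add: abs_mult mult_ac)
  qed
  \<comment> \<open>The hypothesis starts at index one; adding the single term at index zero does
    not affect summability.\<close>
  then have "summable (\<lambda>k. cmod (a k) * hook_root k)"
    by (subst (asm) summable_Suc_iff)
  then show ?thesis
    using L_op_represents[of a] L_op_schatten[of a] by (intro exI[of _ "L_op a"]) auto
qed

end
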